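(* Let $f\in\mathcal F$, let $\beta\in[0,2\pi)$ and $c\in\mathbb R$, and define $g(\alpha)=f(\alpha+\beta)+c$. Then $\psi_g(\alpha)=\psi_f(\alpha)$ for all $\alpha\in[0,2\pi)$.
   Context: $\mathcal F$ is the family of $2\pi$-periodic functions $f:\mathbb S^1\to\mathbb A\subset\mathbb R$ ($\mathbb A$ the real algebraic numbers). For a fixed function $\Phi:\mathbb R\to\mathbb R$ (e.g. $\Phi(z)=e^{-z}$, $e^{-|z|}$ or $e^{-z^2}$), and for a $2\pi$-periodic real function $f$, the sketch (signature) is $$\psi_f(\alpha)=\frac1{2\pi}\int_0^{2\pi}\Phi\big(f(\theta)-f(\theta+\alpha)\big)\,d\theta,\qquad\alpha\in[0,2\pi),$$ where functions are assumed to be such that the integrals exist. *)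

theory Defs
  imports "HOL-Analysis.Analysis" "HOL-Computational_Algebra.Polynomial"
begin

text \<open>
  Functions on the circle are represented by their \<open>2\<pi>\<close>-periodic lifts to the real line, so that
  \<open>\<theta> + \<alpha>\<close> is ordinary addition.
\<close>

definition periodic_2pi :: "(real \<Rightarrow> real) \<Rightarrow> bool" where
  "periodic_2pi f \<longleftrightarrow> (\<forall>\<theta>. f (\<theta> + 2 * pi) = f \<theta>)"

definition algebraic_family :: "(real \<Rightarrow> real) set" where
  "algebraic_family = {f. periodic_2pi f \<and> (\<forall>\<theta>. algebraic (f \<theta>))}"

definition sketch_exists :: "(real \<Rightarrow> real) \<Rightarrow> (real \<Rightarrow> real) \<Rightarrow> bool" where
  "sketch_exists \<Phi> f \<longleftrightarrow>
     (\<forall>\<alpha>\<in>{0..<2 * pi}. set_integrable lebesgue {0..2 * pi} (\<lambda>\<theta>. \<Phi> (f \<theta> - f (\<theta> + \<alpha>))))"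

text \<open>
  The Bochner integral is 0 for a non-integrable integrand, so a value of \<open>sketch\<close> is meaningful
  under \<open>sketch_exists\<close> only, and for \<open>\<alpha>\<close> in \<open>{0..<2 * pi}\<close>.
\<close>

definition sketch :: "(real \<Rightarrow> real) \<Rightarrow> (real \<Rightarrow> real) \<Rightarrow> real \<Rightarrow> real" where
  "sketch \<Phi> f \<alpha> =
     1 / (2 * pi) * (LINT \<theta>:{0..2 * pi}|lebesgue. \<Phi> (f \<theta> - f (\<theta> + \<alpha>)))"

end

theory Submission
  imports Defs
begin

text \<open>The constant \<open>c\<close> cancels in the difference
  \<open>g \<theta> - g (\<theta> + \<alpha>)\<close>, so the integrand for \<open>g\<close> is the
  integrand \<open>h\<close> for \<open>f\<close> translated by \<open>\<beta>\<close>. Since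
  \<open>h\<close> inherits the period \<open>2 * pi\<close>, its integral over a full period does
  not change under translation. This invariance is proved for the gauge integral by cutting and
  rearranging the period, then carried over to the Lebesgue integral.\<close>

lemma has_integral_shift_periodic:
  fixes h :: "real \<Rightarrow> 'a::banach" and T b :: real
  assumes h: "(h has_integral I) {0..T}"
    and periodic: "\<And>x. h (x + T) = h x"
    and b: "0 \<le> b" "b \<le> T"
  shows "((\<lambda>x. h (x + b)) has_integral I) {0..T}"
proof -
  have "h integrable_on {0..T}"
    using h by blast
  then have "h integrable_on {0..b}" "h integrable_on {b..T}"
    using b by (auto intro: integrable_subinterval_real)
  then obtain J K where J: "(h has_integral J) {0..b}" and K: "(h has_integral K) {b..T}"
    by blast
  have "I = J + K"
    using has_integral_combine[OF b J K] h has_integral_unique by blast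
  \<comment> \<open>The two pieces swap places: \<open>{b..T}\<close> moves left by
    \<open>b\<close>, while \<open>{0..b}\<close> moves right by \<open>T - b\<close>, which agrees
    with a left move by \<open>b\<close> modulo the period.\<close>
  moreover have "((\<lambda>x. h (x + b)) has_integral K) {0..T - b}"
    using has_integral_shift_real_ivl[OF K, of b] by simp
  moreover have "((\<lambda>x. h (x + b)) has_integral J) {T - b..T}"
    using has_integral_shift_real_ivl[OF J, of "b - T"] periodic[of "x + (b - T)" for x]
    by (simp add: algebra_simps)
  ultimately show ?thesis
    using has_integral_combine[of 0 "T - b" T "\<lambda>x. h (x + b)" K J] b by (simp add: add.commute)
qed

text \<open>Lebesgue integrability on \<open>{0..T}\<close> amounts to gauge integrability of both
  \<open>h\<close> and its norm, and both are periodic, so the gauge version applies to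
  each.\<close>

lemma set_lebesgue_integral_shift_periodic:
  fixes h :: "real \<Rightarrow> real" and T b :: real
  assumes h: "set_integrable lebesgue {0..T} h"
    and periodic: "\<And>x. h (x + T) = h x"
    and b: "0 \<le> b" "b \<le> T"
  shows "(LINT x:{0..T}|lebesgue. h (x + b)) = (LINT x:{0..T}|lebesgue. h x)"
proof -
  have int: "h integrable_on {0..T}" "(\<lambda>x. norm (h x)) integrable_on {0..T}"
    using h by (auto simp: absolutely_integrable_on_def)
  have shift: "((\<lambda>x. h (x + b)) has_integral integral {0..T} h) {0..T}"
    by (intro has_integral_shift_periodic integrable_integral int periodic b)
  \<comment> \<open>Needed for absolute integrability of the translate; otherwise its Lebesgue
    integral could be the default value 0.\<close>
  have "((\<lambda>x. norm (h (x + b))) has_integral integral {0..T} (\<lambda>x. norm (h x))) {0..T}"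
    by (rule has_integral_shift_periodic[where h = "\<lambda>x. norm (h x)"])
      (use int periodic b in \<open>auto intro: integrable_integral\<close>)
  with shift have "set_integrable lebesgue {0..T} (\<lambda>x. h (x + b))"
    unfolding absolutely_integrable_on_def by blast
  then show ?thesis
    using shift h by (simp add: set_lebesgue_integral_eq_integral integral_unique)
qed

theorem lemma3p1:
  fixes \<Phi> f g :: "real \<Rightarrow> real" and \<beta> c :: real
  assumes "f \<in> algebraic_family"
    and "sketch_exists \<Phi> f"
    and "\<beta> \<in> {0..<2 * pi}"
    and "g = (\<lambda>\<alpha>. f (\<alpha> + \<beta>) + c)"
  shows "\<forall>\<alpha>\<in>{0..<2 * pi}. sketch \<Phi> g \<alpha> = sketch \<Phi> f \<alpha>"
proof
  fix \<alpha> :: real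
  assume \<alpha>: "\<alpha> \<in> {0..<2 * pi}"
  define h where "h = (\<lambda>\<theta>. \<Phi> (f \<theta> - f (\<theta> + \<alpha>)))"
  have f: "f (\<theta> + 2 * pi) = f \<theta>" for \<theta>
    using assms(1) by (simp add: algebraic_family_def periodic_2pi_def)
  have "h (\<theta> + 2 * pi) = h \<theta>" for \<theta>
    using f[of \<theta>] f[of "\<theta> + \<alpha>"] by (simp add: h_def add.assoc add.left_commute add.commute)
  moreover have "set_integrable lebesgue {0..2 * pi} h"
    using assms(2) \<alpha> by (simp add: sketch_exists_def h_def)
  ultimately have "(LINT \<theta>:{0..2 * pi}|lebesgue. h (\<theta> + \<beta>)) = (LINT \<theta>:{0..2 * pi}|lebesgue. h \<theta>)"
    using assms(3) by (intro set_lebesgue_integral_shift_periodic) auto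
  \<comment> \<open>Here \<open>c\<close> cancels, and the translations by \<open>\<alpha>\<close>
    and \<open>\<beta>\<close> commute.\<close>
  moreover have "\<Phi> (g \<theta> - g (\<theta> + \<alpha>)) = h (\<theta> + \<beta>)" for \<theta>
    by (simp add: assms(4) h_def algebra_simps)
  ultimately show "sketch \<Phi> g \<alpha> = sketch \<Phi> f \<alpha>"
    by (simp add: sketch_def h_def)
qed

end
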